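(* Let $Q\ge 3$ and let $m$ be an integer with $$m\ge Q-1+\frac{(Q+2)^2}{4}\ \text{ if $Q$ is even},\qquad m\ge Q-1+\frac{(Q+1)(Q+3)}{4}\ \text{ if $Q$ is odd}.$$ Then in the binary random graph mixture model with $Q$ groups, the parameters $(\pi_q)_{1\le q\le Q}$ and $(p_{ql})_{1\le q\le l\le Q}$ are generically identifiable, up to label swapping, from the joint distribution of $K_{m^2}$. Moreover the same conclusion holds when the group proportions are fixed: for any fixed $\boldsymbol\pi$ in the open simplex, for generic connectivity parameters $(p_{ql})_{1\le q\le l\le Q}$ in $(0,1)^{Q(Q+1)/2}$, the connectivities are identifiable up to label swapping from the distribution of $K_{m^2}$.
   Context: Random graph mixture model: fix $n$ nodes. $Z_1,\dots,Z_n$ are i.i.d. with values in $\{1,\dots,Q\}$, $\pi_q=\mathbb P(Z_i=q)\in(0,1)$, $\sum_q\pi_q=1$. Edge variables $X_{ij}$, $1\le i<j\le n$, are conditionally independent given $(Z_1,\dots,Z_n)$, and the conditional law of $X_{ij}$ depends only on $(Z_i,Z_j)$ through a symmetric family of laws (the law for groups $(q,l)$ equals that for $(l,q)$). In the binary model, $X_{ij}\in\{0,1\}$ and $\mathbb P(X_{ij}=1\mid Z_i=q,Z_j=l)=p_{ql}=p_{lq}$. $K_n$ denotes the collection of all $\binom n2$ edge variables among $n$ nodes (its law does not depend on which $n$ nodes are chosen). "Identifiable up to label swapping from the distribution of $K_n$" means: two parameter values inducing the same joint law of $K_n$ differ only by a permutation $\sigma$ of $\{1,\dots,Q\}$ applied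 simultaneously to all group-indexed parameters ($\pi_q\mapsto\pi_{\sigma(q)}$, $p_{ql}\mapsto p_{\sigma(q)\sigma(l)}$). "Generically identifiable" means identifiability holds for all parameter values outside a proper algebraic subvariety (the zero set of some not-identically-zero polynomials) of the parameter space, hence outside a Lebesgue-null set; here the parameter space is the open simplex of $\boldsymbol\pi$ times $(0,1)^{Q(Q+1)/2}$. *)

theory Defs
  imports Complex_Main "HOL-Library.FuncSet" "HOL-Combinatorics.Permutations"
begin

text \<open>Groups are labelled 0..<Q, nodes 0..<n. Group proportions w :: nat => real,
 connectivities p :: nat => nat => real (only entries with indices < Q matter).\<close>

definition open_simplex :: "nat \<Rightarrow> (nat \<Rightarrow> real) \<Rightarrow> bool" where
  "open_simplex Q w \<longleftrightarrow> (\<forall>q<Q. 0 < w q) \<and> (\<Sum>q<Q. w q) = 1"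

definition conn_space :: "nat \<Rightarrow> (nat \<Rightarrow> nat \<Rightarrow> real) \<Rightarrow> bool" where
  "conn_space Q p \<longleftrightarrow> (\<forall>q<Q. \<forall>l<Q. 0 < p q l \<and> p q l < 1 \<and> p q l = p l q)"

definition param_space :: "nat \<Rightarrow> (nat \<Rightarrow> real) \<Rightarrow> (nat \<Rightarrow> nat \<Rightarrow> real) \<Rightarrow> bool" where
  "param_space Q w p \<longleftrightarrow> open_simplex Q w \<and> conn_space Q p"

definition law_K :: "nat \<Rightarrow> nat \<Rightarrow> (nat \<Rightarrow> real) \<Rightarrow> (nat \<Rightarrow> nat \<Rightarrow> real)
    \<Rightarrow> (nat \<Rightarrow> nat \<Rightarrow> bool) \<Rightarrow> real" where
  "law_K n Q w p x =
     (\<Sum>z \<in> {..<n} \<rightarrow>\<^sub>E {..<Q}.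
        (\<Prod>i<n. w (z i)) *
        (\<Prod>(i,j) \<in> {(i,j). i < j \<and> j < n}.
            if x i j then p (z i) (z j) else 1 - p (z i) (z j)))"

definition param_poly :: "nat \<Rightarrow> ((nat \<Rightarrow> real) \<Rightarrow> (nat \<Rightarrow> nat \<Rightarrow> real) \<Rightarrow> real) \<Rightarrow> bool" where
  "param_poly Q F \<longleftrightarrow> (\<exists>M :: ((nat \<Rightarrow> nat) \<times> (nat \<Rightarrow> nat \<Rightarrow> nat)) set. \<exists>c. finite M \<and>
     (\<forall>w p. F w p = (\<Sum>(a,b)\<in>M. c (a,b) * (\<Prod>q<Q. w q ^ a q) *
                                      (\<Prod>q<Q. \<Prod>l<Q. p q l ^ b q l))))"

definition conn_poly :: "nat \<Rightarrow> ((nat \<Rightarrow> nat \<Rightarrow> real) \<Rightarrow> real) \<Rightarrow> bool" where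
  "conn_poly Q G \<longleftrightarrow> (\<exists>M :: (nat \<Rightarrow> nat \<Rightarrow> nat) set. \<exists>c. finite M \<and>
     (\<forall>p. G p = (\<Sum>b\<in>M. c b * (\<Prod>q<Q. \<Prod>l<Q. p q l ^ b q l))))"

end

theory Submission
  imports Defs "HOL-Computational_Algebra.Polynomial" "HOL-Library.Function_Algebras"
begin

(* For a node of group q let theta q = sum_l w l * p q l be its expected
   edge probability.  The law of K_n determines the expectation of every product of edge
   indicators; for "double stars" (two centre nodes 0 and 1, disjoint leaf sets, optional
   edge between the centres) these expectations are
     sum_{q,l} g q l * w q * w l * theta q ^ a * theta l ^ b,   g = 1 or g = p.
   With n >= 2Q+1 this gives all moments sum_q w q * theta q ^ k for k < 2Q and all mixed
   moments sum_{q,l} p q l w q w l theta q ^ a theta l ^ b for a, b < Q.  By Lagrange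
   interpolation the first family determines the distribution of theta under w; when the
   theta q are pairwise distinct this recovers w and theta up to a permutation sigma, and
   then the second family, tested against indicator polynomials, recovers p.  Genericity is
   the nonvanishing of the polynomial prod_{q<r} (theta q - theta r). *)

section \<open>Polynomial functions of the parameters\<close>

definition monomial_pp :: "nat \<Rightarrow> (nat \<Rightarrow> nat) \<Rightarrow> (nat \<Rightarrow> nat \<Rightarrow> nat)
    \<Rightarrow> (nat \<Rightarrow> real) \<Rightarrow> (nat \<Rightarrow> nat \<Rightarrow> real) \<Rightarrow> real" where
  "monomial_pp Q a b w p = (\<Prod>q<Q. w q ^ a q) * (\<Prod>q<Q. \<Prod>l<Q. p q l ^ b q l)"

lemma param_poly_alt:
  "param_poly Q F \<longleftrightarrow>
     (\<exists>M c. finite M \<and> (\<forall>w p. F w p = (\<Sum>m\<in>M. c m * monomial_pp Q (fst m) (snd m) w p)))"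
  unfolding param_poly_def monomial_pp_def by (simp add: split_def mult.assoc)

lemma monomial_pp_add:
  "monomial_pp Q (a1 + a2) (b1 + b2) w p = monomial_pp Q a1 b1 w p * monomial_pp Q a2 b2 w p"
  unfolding monomial_pp_def by (simp add: power_add prod.distrib mult_ac)

lemma param_poly_const: "param_poly Q (\<lambda>w p. c)"
  unfolding param_poly_alt
  by (rule exI[of _ "{(\<lambda>_. 0, \<lambda>_ _. 0)}"], rule exI[of _ "\<lambda>_. c"]) (simp add: monomial_pp_def)

lemma param_poly_weight:
  assumes "q < Q"
  shows "param_poly Q (\<lambda>w p. w q)"
proof -
  have "(\<Prod>i<Q. w i ^ (if i = q then 1 else 0)) = w q" for w :: "nat \<Rightarrow> real"
    using assms by (subst prod.mono_neutral_right[of "{..<Q}" "{q}"]) auto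
  then show ?thesis unfolding param_poly_alt
    by (intro exI[of _ "{(\<lambda>i. if i = q then 1 else 0, \<lambda>_ _. 0)}"] exI[of _ "\<lambda>_. 1"])
       (simp add: monomial_pp_def)
qed

lemma param_poly_conn:
  assumes "q < Q" "l < Q"
  shows "param_poly Q (\<lambda>w p. p q l)"
proof -
  have "(\<Prod>i<Q. \<Prod>j<Q. p i j ^ (if i = q \<and> j = l then 1 else 0)) = p q l"
    for p :: "nat \<Rightarrow> nat \<Rightarrow> real"
  proof -
    have "(\<Prod>i<Q. \<Prod>j<Q. p i j ^ (if i = q \<and> j = l then 1 else 0))
        = (\<Prod>i<Q. if i = q then p q l else 1)"
      using assms by (intro prod.cong refl)
        (auto simp: prod.delta' if_distrib cong: if_cong)
    also have "\<dots> = p q l" using assms by (simp add: prod.delta')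
    finally show ?thesis .
  qed
  then show ?thesis unfolding param_poly_alt
    by (intro exI[of _ "{(\<lambda>_. 0, \<lambda>i j. if i = q \<and> j = l then 1 else 0)}"] exI[of _ "\<lambda>_. 1"])
       (simp add: monomial_pp_def)
qed

lemma param_poly_add:
  assumes "param_poly Q F" "param_poly Q G"
  shows "param_poly Q (\<lambda>w p. F w p + G w p)"
proof -
  obtain M1 c1 where M1: "finite M1"
    and F: "\<And>w p. F w p = (\<Sum>m\<in>M1. c1 m * monomial_pp Q (fst m) (snd m) w p)"
    using assms(1) unfolding param_poly_alt by blast
  obtain M2 c2 where M2: "finite M2"
    and G: "\<And>w p. G w p = (\<Sum>m\<in>M2. c2 m * monomial_pp Q (fst m) (snd m) w p)"
    using assms(2) unfolding param_poly_alt by blast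
  define c where "c m = (if m \<in> M1 then c1 m else 0) + (if m \<in> M2 then c2 m else 0)" for m
  have "F w p + G w p = (\<Sum>m\<in>M1 \<union> M2. c m * monomial_pp Q (fst m) (snd m) w p)" for w p
  proof -
    have "(\<Sum>m\<in>M1 \<union> M2. c m * monomial_pp Q (fst m) (snd m) w p) =
       (\<Sum>m\<in>M1 \<union> M2. (if m \<in> M1 then c1 m * monomial_pp Q (fst m) (snd m) w p else 0))
      + (\<Sum>m\<in>M1 \<union> M2. (if m \<in> M2 then c2 m * monomial_pp Q (fst m) (snd m) w p else 0))"
      unfolding sum.distrib[symmetric] by (rule sum.cong) (auto simp: c_def distrib_right)
    also have "\<dots> = F w p + G w p"
      unfolding F G using M1 M2
      by (intro arg_cong2[where f="(+)"] sum.mono_neutral_cong_right) auto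
    finally show ?thesis by simp
  qed
  then show ?thesis unfolding param_poly_alt using M1 M2 by blast
qed

lemma param_poly_mult:
  assumes "param_poly Q F" "param_poly Q G"
  shows "param_poly Q (\<lambda>w p. F w p * G w p)"
proof -
  obtain M1 c1 where M1: "finite M1"
    and F: "\<And>w p. F w p = (\<Sum>m\<in>M1. c1 m * monomial_pp Q (fst m) (snd m) w p)"
    using assms(1) unfolding param_poly_alt by blast
  obtain M2 c2 where M2: "finite M2"
    and G: "\<And>w p. G w p = (\<Sum>m\<in>M2. c2 m * monomial_pp Q (fst m) (snd m) w p)"
    using assms(2) unfolding param_poly_alt by blast
  define h where "h = (\<lambda>(m1::(nat \<Rightarrow> nat) \<times> (nat \<Rightarrow> nat \<Rightarrow> nat), m2::(nat \<Rightarrow> nat) \<times> (nat \<Rightarrow> nat \<Rightarrow> nat)).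
                         (fst m1 + fst m2, snd m1 + snd m2))"
  define c where "c m = (\<Sum>x\<in>{x\<in>M1 \<times> M2. h x = m}. c1 (fst x) * c2 (snd x))" for m
  have "F w p * G w p = (\<Sum>m\<in>h ` (M1 \<times> M2). c m * monomial_pp Q (fst m) (snd m) w p)" for w p
  proof -
    have "F w p * G w p = (\<Sum>x\<in>M1 \<times> M2.
            c1 (fst x) * c2 (snd x) * monomial_pp Q (fst (h x)) (snd (h x)) w p)"
      unfolding F G sum_product sum.cartesian_product h_def
      by (rule sum.cong) (auto simp: monomial_pp_add split_def mult_ac)
    also have "\<dots> = (\<Sum>m\<in>h ` (M1 \<times> M2). \<Sum>x\<in>{x\<in>M1 \<times> M2. h x = m}.
            c1 (fst x) * c2 (snd x) * monomial_pp Q (fst (h x)) (snd (h x)) w p)"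
      using M1 M2 by (rule_tac sum.image_gen) auto
    also have "\<dots> = (\<Sum>m\<in>h ` (M1 \<times> M2). c m * monomial_pp Q (fst m) (snd m) w p)"
      unfolding c_def sum_distrib_right by (rule sum.cong, simp, rule sum.cong) auto
    finally show ?thesis .
  qed
  then show ?thesis unfolding param_poly_alt using M1 M2
    by (intro exI[of _ "h ` (M1 \<times> M2)"] exI[of _ c]) auto
qed

lemma param_poly_sum:
  "finite A \<Longrightarrow> (\<And>i. i \<in> A \<Longrightarrow> param_poly Q (f i)) \<Longrightarrow> param_poly Q (\<lambda>w p. \<Sum>i\<in>A. f i w p)"
  by (induction A rule: finite_induct) (auto intro: param_poly_add param_poly_const)

lemma param_poly_prod:
  "finite A \<Longrightarrow> (\<And>i. i \<in> A \<Longrightarrow> param_poly Q (f i)) \<Longrightarrow> param_poly Q (\<lambda>w p. \<Prod>i\<in>A. f i w p)"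
  by (induction A rule: finite_induct) (auto intro: param_poly_mult param_poly_const)

lemma param_poly_diff:
  "param_poly Q F \<Longrightarrow> param_poly Q G \<Longrightarrow> param_poly Q (\<lambda>w p. F w p - G w p)"
  using param_poly_add[of Q F "\<lambda>w p. (-1) * G w p"] param_poly_mult[OF param_poly_const[of Q "-1"], of G]
  by simp

lemma param_poly_fix_weights:
  assumes "param_poly Q F"
  shows "conn_poly Q (F w)"
proof -
  obtain M c where M: "finite M"
    and F: "\<And>w p. F w p = (\<Sum>m\<in>M. c m * monomial_pp Q (fst m) (snd m) w p)"
    using assms unfolding param_poly_alt by blast
  define d where "d b = (\<Sum>m\<in>{m\<in>M. snd m = b}. c m * (\<Prod>q<Q. w q ^ fst m q))" for b
  have "F w p = (\<Sum>b\<in>snd ` M. d b * (\<Prod>q<Q. \<Prod>l<Q. p q l ^ b q l))" for p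
  proof -
    have "F w p = (\<Sum>b\<in>snd ` M. \<Sum>m\<in>{m\<in>M. snd m = b}. c m * monomial_pp Q (fst m) (snd m) w p)"
      unfolding F using M by (rule sum.image_gen)
    also have "\<dots> = (\<Sum>b\<in>snd ` M. d b * (\<Prod>q<Q. \<Prod>l<Q. p q l ^ b q l))"
      unfolding d_def sum_distrib_right monomial_pp_def
      by (rule sum.cong, simp, rule sum.cong) (auto simp: mult_ac)
    finally show ?thesis .
  qed
  then show ?thesis unfolding conn_poly_def using M by (intro exI[of _ "snd ` M"] exI[of _ d]) auto
qed

section \<open>Edge moments of the law of K_n\<close>

definition pairs :: "nat \<Rightarrow> (nat \<times> nat) set" where
  "pairs n = {(i,j). i < j \<and> j < n}"

lemma finite_pairs: "finite (pairs n)"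
  by (rule finite_subset[of _ "{..<n} \<times> {..<n}"]) (auto simp: pairs_def)

lemma bernoulli_all_success:
  fixes P :: "'e \<Rightarrow> real"
  assumes A: "finite A" and E: "E \<subseteq> A"
  shows "(\<Sum>y\<in>A \<rightarrow>\<^sub>E (UNIV::bool set).
            (\<Prod>e\<in>A. if y e then P e else 1 - P e) * (\<Prod>e\<in>E. if y e then 1 else 0))
       = (\<Prod>e\<in>E. P e)"
proof -
  have AE: "A \<inter> E = E" using E by blast
  have restrict: "(\<Prod>e\<in>E. f e) = (\<Prod>e\<in>A. if e \<in> E then f e else 1)" for f :: "'e \<Rightarrow> real"
    using prod.inter_restrict[OF A, of f E] AE by simp
  have "(\<Sum>y\<in>A \<rightarrow>\<^sub>E (UNIV::bool set).
            (\<Prod>e\<in>A. if y e then P e else 1 - P e) * (\<Prod>e\<in>E. if y e then 1 else 0))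
      = (\<Sum>y\<in>A \<rightarrow>\<^sub>E (UNIV::bool set). \<Prod>e\<in>A.
            (if y e then P e else 1 - P e) * (if e \<in> E then (if y e then 1 else 0) else 1))"
    by (intro sum.cong refl) (simp add: restrict[of "\<lambda>e. if _ e then 1 else 0"] prod.distrib)
  also have "\<dots> = (\<Prod>e\<in>A. \<Sum>b\<in>(UNIV::bool set).
            (if b then P e else 1 - P e) * (if e \<in> E then (if b then 1 else 0) else 1))"
    by (rule prod_sum_PiE[symmetric]) (use A in auto)
  also have "\<dots> = (\<Prod>e\<in>A. if e \<in> E then P e else 1)"
    by (rule prod.cong[OF refl]) (simp add: UNIV_bool)
  also have "\<dots> = (\<Prod>e\<in>E. P e)" by (simp add: restrict)
  finally show ?thesis .
qed

lemma law_edge_moment: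
  assumes E: "E \<subseteq> pairs n"
  shows "(\<Sum>y\<in>pairs n \<rightarrow>\<^sub>E (UNIV::bool set).
            law_K n Q w p (\<lambda>i j. y (i,j)) * (\<Prod>e\<in>E. if y e then 1 else 0))
       = (\<Sum>z\<in>{..<n} \<rightarrow>\<^sub>E {..<Q}. (\<Prod>i<n. w (z i)) * (\<Prod>e\<in>E. p (z (fst e)) (z (snd e))))"
proof -
  define P where "P z e = p (z (fst e)) (z (snd e))" for z :: "nat \<Rightarrow> nat" and e :: "nat \<times> nat"
  have edges: "(\<lambda>(i,j). if y (i,j) then p (z i) (z j) else 1 - p (z i) (z j))
             = (\<lambda>e. if y e then P z e else 1 - P z e)" for y z
    by (rule ext) (simp add: P_def split_def)
  have law: "law_K n Q w p (\<lambda>i j. y (i,j)) = (\<Sum>z\<in>{..<n} \<rightarrow>\<^sub>E {..<Q}.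
              (\<Prod>i<n. w (z i)) * (\<Prod>e\<in>pairs n. if y e then P z e else 1 - P z e))" for y
    unfolding law_K_def pairs_def edges ..
  have "(\<Sum>y\<in>pairs n \<rightarrow>\<^sub>E (UNIV::bool set).
            law_K n Q w p (\<lambda>i j. y (i,j)) * (\<Prod>e\<in>E. if y e then 1 else 0))
     = (\<Sum>z\<in>{..<n} \<rightarrow>\<^sub>E {..<Q}. (\<Prod>i<n. w (z i)) * (\<Sum>y\<in>pairs n \<rightarrow>\<^sub>E (UNIV::bool set).
            (\<Prod>e\<in>pairs n. if y e then P z e else 1 - P z e) * (\<Prod>e\<in>E. if y e then 1 else 0)))"
    unfolding law sum_distrib_right sum_distrib_left
    by (subst sum.swap) (simp add: mult.assoc)
  also have "\<dots> = (\<Sum>z\<in>{..<n} \<rightarrow>\<^sub>E {..<Q}. (\<Prod>i<n. w (z i)) * (\<Prod>e\<in>E. P z e))"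
    by (simp add: bernoulli_all_success[OF finite_pairs E])
  finally show ?thesis unfolding P_def .
qed

lemma law_edge_moment_eq:
  assumes "E \<subseteq> pairs n" "law_K n Q w p = law_K n Q w' p'"
  shows "(\<Sum>z\<in>{..<n} \<rightarrow>\<^sub>E {..<Q}. (\<Prod>i<n. w (z i)) * (\<Prod>e\<in>E. p (z (fst e)) (z (snd e))))
       = (\<Sum>z\<in>{..<n} \<rightarrow>\<^sub>E {..<Q}. (\<Prod>i<n. w' (z i)) * (\<Prod>e\<in>E. p' (z (fst e)) (z (snd e))))"
  using law_edge_moment[OF assms(1), of Q w p] law_edge_moment[OF assms(1), of Q w' p'] assms(2)
  by simp

section \<open>Double-star moments\<close>

definition theta :: "nat \<Rightarrow> (nat \<Rightarrow> real) \<Rightarrow> (nat \<Rightarrow> nat \<Rightarrow> real) \<Rightarrow> nat \<Rightarrow> real" where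
  "theta Q w p q = (\<Sum>l<Q. w l * p q l)"

definition double_star :: "bool \<Rightarrow> nat set \<Rightarrow> nat set \<Rightarrow> (nat \<times> nat) set" where
  "double_star centre_edge S T =
     (if centre_edge then {(0,1)} else {}) \<union> (\<lambda>j. (0,j)) ` S \<union> (\<lambda>j. (1,j)) ` T"

lemma double_star_pairs:
  "S \<subseteq> {2..<n} \<Longrightarrow> T \<subseteq> {2..<n} \<Longrightarrow> 2 \<le> n \<Longrightarrow> double_star c S T \<subseteq> pairs n"
  unfolding double_star_def pairs_def by auto

lemma prod_double_star:
  fixes g :: "nat \<times> nat \<Rightarrow> real"
  assumes "S \<subseteq> {2..<n}" "T \<subseteq> {2..<n}"
  shows "(\<Prod>e\<in>double_star c S T. g e)
       = (if c then g (0,1) else 1) * (\<Prod>j\<in>S. g (0,j)) * (\<Prod>j\<in>T. g (1,j))"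
proof -
  have fin: "finite S" "finite T" using finite_subset[OF assms(1)] finite_subset[OF assms(2)] by auto
  have inj: "inj_on (\<lambda>j. (0::nat,j)) S" "inj_on (\<lambda>j. (1::nat,j)) T" by (auto simp: inj_on_def)
  have d1: "((if c then {(0,1)} else {}) \<union> (\<lambda>j. (0::nat,j)) ` S) \<inter> (\<lambda>j. (1,j)) ` T = {}"
    by auto
  have d2: "(if c then {(0::nat,1::nat)} else {}) \<inter> (\<lambda>j. (0,j)) ` S = {}" using assms by auto
  have "(\<Prod>e\<in>double_star c S T. g e)
      = (\<Prod>e\<in>(if c then {(0,1)} else {}) \<union> (\<lambda>j. (0,j)) ` S. g e) * (\<Prod>e\<in>(\<lambda>j. (1,j)) ` T. g e)"
    unfolding double_star_def by (rule prod.union_disjoint) (use fin d1 in auto)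
  also have "(\<Prod>e\<in>(if c then {(0,1)} else {}) \<union> (\<lambda>j. (0,j)) ` S. g e)
      = (\<Prod>e\<in>(if c then {(0,1)} else {}). g e) * (\<Prod>e\<in>(\<lambda>j. (0,j)) ` S. g e)"
    by (rule prod.union_disjoint) (use fin d2 in auto)
  finally
  show ?thesis using prod.reindex[OF inj(1), of g] prod.reindex[OF inj(2), of g] by (simp add: o_def)
qed

lemma sum_sum_delta:
  fixes X :: real and a b Q :: nat
  assumes "a < Q" "b < Q"
  shows "(\<Sum>q<Q. \<Sum>l<Q. if a = q \<and> b = l then X else 0) = X"
proof -
  have "(\<Sum>q<Q. \<Sum>l<Q. if a = q \<and> b = l then X else 0)
      = (\<Sum>q<Q. if a = q then (\<Sum>l<Q. if b = l then X else 0) else 0)"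
    by (rule sum.cong) auto
  also have "\<dots> = (\<Sum>q<Q. if a = q then X else 0)"
    using assms(2) by (intro sum.cong) auto
  also have "\<dots> = X" using assms(1) by auto
  finally show ?thesis .
qed

lemma sum_assignments_by_first_two:
  fixes n Q :: nat and F :: "(nat \<Rightarrow> nat) \<Rightarrow> real"
  assumes "2 \<le> n"
  shows "(\<Sum>z\<in>{..<n} \<rightarrow>\<^sub>E {..<Q}. F z)
       = (\<Sum>q<Q. \<Sum>l<Q. \<Sum>z\<in>{..<n} \<rightarrow>\<^sub>E {..<Q}. if z 0 = q \<and> z 1 = l then F z else 0)"
proof -
  have "F z = (\<Sum>q<Q. \<Sum>l<Q. if z 0 = q \<and> z 1 = l then F z else 0)"
    if "z \<in> {..<n} \<rightarrow>\<^sub>E {..<Q}" for z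
  proof -
    have "z 0 < Q" "z 1 < Q" using PiE_mem[OF that, of 0] PiE_mem[OF that, of 1] assms by auto
    then show ?thesis by (rule sum_sum_delta[symmetric])
  qed
  then have "(\<Sum>z\<in>{..<n} \<rightarrow>\<^sub>E {..<Q}. F z)
      = (\<Sum>z\<in>{..<n} \<rightarrow>\<^sub>E {..<Q}. \<Sum>q<Q. \<Sum>l<Q. if z 0 = q \<and> z 1 = l then F z else 0)"
    by (rule sum.cong[OF refl])
  also have "\<dots> = (\<Sum>q<Q. \<Sum>l<Q. \<Sum>z\<in>{..<n} \<rightarrow>\<^sub>E {..<Q}. if z 0 = q \<and> z 1 = l then F z else 0)"
    by (subst sum.swap) (subst sum.swap, rule refl)
  finally show ?thesis .
qed

text \<open>With the centres in groups q and l, the integrand of a double-star moment factorises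
  over the nodes: node 0 is forced into q, node 1 into l, and node i \<ge> 2 contributes
  its weight times its edge probabilities to the centres it is joined to.\<close>
definition star_factor ::
    "(nat \<Rightarrow> real) \<Rightarrow> (nat \<Rightarrow> nat \<Rightarrow> real) \<Rightarrow> nat set \<Rightarrow> nat set \<Rightarrow> nat \<Rightarrow> nat \<Rightarrow> nat \<Rightarrow> nat \<Rightarrow> real" where
  "star_factor w p S T q l i a =
     (if i = 0 then (if a = q then w a else 0)
      else if i = 1 then (if a = l then w a else 0)
      else w a * (if i \<in> S then p q a else 1) * (if i \<in> T then p l a else 1))"

lemma double_star_integrand_factor:
  fixes n :: nat
  assumes n: "2 \<le> n" and S: "S \<subseteq> {2..<n}" and T: "T \<subseteq> {2..<n}"
  shows "(if z 0 = q \<and> z 1 = l then (\<Prod>i<n. w (z i)) * (\<Prod>j\<in>S. p (z 0) (z j)) * (\<Prod>j\<in>T. p (z 1) (z j))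
          else 0)
       = (\<Prod>i<n. star_factor w p S T q l i (z i))"
proof -
  have split_n: "{..<n} = insert 0 (insert 1 {2..<n})" using n by auto
  have restrict: "(\<Prod>j\<in>A. f j) = (\<Prod>i\<in>{2..<n}. if i \<in> A then f i else 1)"
    if "A \<subseteq> {2..<n}" for A and f :: "nat \<Rightarrow> real"
    using prod.inter_restrict[of "{2..<n}" f A] that by (simp add: Int_absorb1)
  have leaves: "(\<Prod>i\<in>{2..<n}. star_factor w p S T q l i (z i))
      = (\<Prod>i\<in>{2..<n}. w (z i)) * (\<Prod>j\<in>S. p q (z j)) * (\<Prod>j\<in>T. p l (z j))"
    by (simp add: restrict[OF S] restrict[OF T] prod.distrib[symmetric] star_factor_def)
  have nodes: "(\<Prod>i<n. star_factor w p S T q l i (z i)) = star_factor w p S T q l 0 (z 0)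
      * star_factor w p S T q l 1 (z 1) * (\<Prod>i\<in>{2..<n}. star_factor w p S T q l i (z i))"
    unfolding split_n by simp
  have weights: "(\<Prod>i<n. w (z i)) = w (z 0) * w (z 1) * (\<Prod>i\<in>{2..<n}. w (z i))"
    unfolding split_n by simp
  show ?thesis
  proof (cases "z 0 = q \<and> z 1 = l")
    case True
    have centres: "star_factor w p S T q l 0 (z 0) = w (z 0)" "star_factor w p S T q l 1 (z 1) = w (z 1)"
      using True by (simp_all add: star_factor_def)
    show ?thesis unfolding nodes leaves weights centres using True by (simp add: mult_ac)
  next
    case False
    then have centres: "star_factor w p S T q l 0 (z 0) * star_factor w p S T q l 1 (z 1) = 0"
      by (auto simp: star_factor_def)
    show ?thesis unfolding nodes by (simp only: if_not_P[OF False] centres mult_zero_left)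
  qed
qed

text \<open>Summing the factorised integrand: each leaf averages to a power of theta.\<close>
lemma sum_star_factor:
  fixes n :: nat and S T :: "nat set"
  assumes n: "2 \<le> n" and S: "S \<subseteq> {2..<n}" and T: "T \<subseteq> {2..<n}" and ST: "S \<inter> T = {}"
    and w1: "(\<Sum>l<Q. w l) = 1" and q: "q < Q" and l: "l < Q"
  shows "(\<Sum>z\<in>{..<n} \<rightarrow>\<^sub>E {..<Q}. \<Prod>i<n. star_factor w p S T q l i (z i))
       = w q * w l * theta Q w p q ^ card S * theta Q w p l ^ card T"
proof -
  have split_n: "{..<n} = insert 0 (insert 1 {2..<n})" using n by auto
  have restrict: "(\<Prod>j\<in>A. f j) = (\<Prod>i\<in>{2..<n}. if i \<in> A then f i else 1)"
    if "A \<subseteq> {2..<n}" for A and f :: "nat \<Rightarrow> real"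
    using prod.inter_restrict[of "{2..<n}" f A] that by (simp add: Int_absorb1)
  have leaf: "(\<Sum>a<Q. star_factor w p S T q l i a)
      = (if i \<in> S then theta Q w p q else 1) * (if i \<in> T then theta Q w p l else 1)"
    if "i \<in> {2..<n}" for i
    using that ST w1 by (cases "i \<in> S"; cases "i \<in> T") (auto simp: star_factor_def theta_def)
  have "(\<Sum>z\<in>{..<n} \<rightarrow>\<^sub>E {..<Q}. \<Prod>i<n. star_factor w p S T q l i (z i))
      = (\<Prod>i<n. \<Sum>a<Q. star_factor w p S T q l i a)"
    by (rule prod_sum_PiE[symmetric]) auto
  also have "\<dots> = w q * w l * (\<Prod>i\<in>{2..<n}. \<Sum>a<Q. star_factor w p S T q l i a)"
    unfolding split_n using q l by (simp add: star_factor_def)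
  also have "(\<Prod>i\<in>{2..<n}. \<Sum>a<Q. star_factor w p S T q l i a) = (\<Prod>i\<in>{2..<n}.
                (if i \<in> S then theta Q w p q else 1) * (if i \<in> T then theta Q w p l else 1))"
    by (rule prod.cong[OF refl leaf])
  also have "w q * w l * \<dots> = w q * w l * theta Q w p q ^ card S * theta Q w p l ^ card T"
    by (simp add: prod.distrib restrict[OF S, symmetric] restrict[OF T, symmetric])
  finally show ?thesis .
qed

lemma double_star_moment:
  fixes n :: nat and S T :: "nat set"
  assumes n: "2 \<le> n" and S: "S \<subseteq> {2..<n}" and T: "T \<subseteq> {2..<n}" and ST: "S \<inter> T = {}"
    and w1: "(\<Sum>l<Q. w l) = 1"
  shows "(\<Sum>z\<in>{..<n} \<rightarrow>\<^sub>E {..<Q}. (\<Prod>i<n. w (z i)) *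
            (g (z 0) (z 1) * (\<Prod>j\<in>S. p (z 0) (z j)) * (\<Prod>j\<in>T. p (z 1) (z j))))
    = (\<Sum>q<Q. \<Sum>l<Q. g q l * (w q * w l * theta Q w p q ^ card S * theta Q w p l ^ card T))"
  (is "(\<Sum>z\<in>_. ?F z) = _")
proof -
  have centres_fixed: "(\<Sum>z\<in>{..<n} \<rightarrow>\<^sub>E {..<Q}. if z 0 = q \<and> z 1 = l then ?F z else 0)
      = g q l * (w q * w l * theta Q w p q ^ card S * theta Q w p l ^ card T)"
    if "q < Q" "l < Q" for q l
  proof -
    have "(if z 0 = q \<and> z 1 = l then ?F z else 0)
        = g q l * (\<Prod>i<n. star_factor w p S T q l i (z i))" for z
    proof (cases "z 0 = q \<and> z 1 = l")
      case True
      then show ?thesis using double_star_integrand_factor[OF n S T, of z q l w p] by (simp add: mult_ac)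
    next
      case False
      have "(\<Prod>i<n. star_factor w p S T q l i (z i)) = 0"
        using double_star_integrand_factor[OF n S T, of z q l w p] unfolding if_not_P[OF False] by simp
      then show ?thesis unfolding if_not_P[OF False] by simp
    qed
    then have "(\<Sum>z\<in>{..<n} \<rightarrow>\<^sub>E {..<Q}. if z 0 = q \<and> z 1 = l then ?F z else 0)
        = g q l * (\<Sum>z\<in>{..<n} \<rightarrow>\<^sub>E {..<Q}. \<Prod>i<n. star_factor w p S T q l i (z i))"
      by (simp add: sum_distrib_left)
    then show ?thesis by (simp only: sum_star_factor[OF n S T ST w1 that])
  qed
  show ?thesis
    by (subst sum_assignments_by_first_two[OF n]) (intro sum.cong refl centres_fixed; simp)
qed

lemma double_star_moment_eq:
  fixes n :: nat and S T :: "nat set"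
  assumes law: "law_K n Q w p = law_K n Q w' p'" and n: "2 \<le> n"
    and S: "S \<subseteq> {2..<n}" and T: "T \<subseteq> {2..<n}" and ST: "S \<inter> T = {}"
    and w1: "(\<Sum>l<Q. w l) = 1" and w1': "(\<Sum>l<Q. w' l) = 1"
  shows "(\<Sum>q<Q. \<Sum>l<Q. (if c then p q l else 1) *
            (w q * w l * theta Q w p q ^ card S * theta Q w p l ^ card T))
       = (\<Sum>q<Q. \<Sum>l<Q. (if c then p' q l else 1) *
            (w' q * w' l * theta Q w' p' q ^ card S * theta Q w' p' l ^ card T))"
proof -
  have edges: "(\<Prod>e\<in>double_star c S T. r (z (fst e)) (z (snd e)))
      = (if c then r (z 0) (z 1) else 1) * (\<Prod>j\<in>S. r (z 0) (z j)) * (\<Prod>j\<in>T. r (z 1) (z j))"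
    for r :: "nat \<Rightarrow> nat \<Rightarrow> real" and z :: "nat \<Rightarrow> nat"
    using prod_double_star[OF S T, of "\<lambda>e. r (z (fst e)) (z (snd e))" c] by simp
  have "(\<Sum>z\<in>{..<n} \<rightarrow>\<^sub>E {..<Q}. (\<Prod>i<n. w (z i)) * ((if c then p (z 0) (z 1) else 1) *
            (\<Prod>j\<in>S. p (z 0) (z j)) * (\<Prod>j\<in>T. p (z 1) (z j))))
      = (\<Sum>z\<in>{..<n} \<rightarrow>\<^sub>E {..<Q}. (\<Prod>i<n. w' (z i)) * ((if c then p' (z 0) (z 1) else 1) *
            (\<Prod>j\<in>S. p' (z 0) (z j)) * (\<Prod>j\<in>T. p' (z 1) (z j))))"
    using law_edge_moment_eq[OF double_star_pairs[OF S T n, of c] law] unfolding edges .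
  then show ?thesis
    unfolding double_star_moment[OF n S T ST w1, of "\<lambda>q l. if c then p q l else 1"]
              double_star_moment[OF n S T ST w1', of "\<lambda>q l. if c then p' q l else 1"] .
qed

text \<open>Single stars (no centre edge, no leaves at node 1): the moments of theta under w.\<close>
lemma theta_moment_eq:
  assumes law: "law_K n Q w p = law_K n Q w' p'" and k: "k + 2 \<le> n"
    and w1: "(\<Sum>l<Q. w l) = 1" and w1': "(\<Sum>l<Q. w' l) = 1"
  shows "(\<Sum>q<Q. w q * theta Q w p q ^ k) = (\<Sum>q<Q. w' q * theta Q w' p' q ^ k)"
proof -
  have collapse: "(\<Sum>q<Q. \<Sum>l<Q. u q * u l * x q) = (\<Sum>q<Q. u q * x q)"
    if u1: "(\<Sum>l<Q. u l) = 1" for u x :: "nat \<Rightarrow> real"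
  proof (rule sum.cong[OF refl])
    fix q
    have "(\<Sum>l<Q. u q * u l * x q) = u q * x q * (\<Sum>l<Q. u l)" by (simp add: sum_distrib_left mult_ac)
    then show "(\<Sum>l<Q. u q * u l * x q) = u q * x q" using u1 by simp
  qed
  have "(\<Sum>q<Q. \<Sum>l<Q. w q * w l * theta Q w p q ^ k) = (\<Sum>q<Q. \<Sum>l<Q. w' q * w' l * theta Q w' p' q ^ k)"
    using double_star_moment_eq[OF law _ _ _ _ w1 w1', of "{2..<2+k}" "{}" False] k by simp
  then show ?thesis by (simp only: collapse[OF w1] collapse[OF w1'])
qed

text \<open>Double stars with the centre edge: mixed moments weighted by the connectivity.\<close>
lemma edge_theta_moment_eq:
  assumes law: "law_K n Q w p = law_K n Q w' p'" and n: "a + b + 2 \<le> n"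
    and w1: "(\<Sum>l<Q. w l) = 1" and w1': "(\<Sum>l<Q. w' l) = 1"
  shows "(\<Sum>q<Q. \<Sum>l<Q. p q l * (w q * w l) * (theta Q w p q ^ a * theta Q w p l ^ b))
       = (\<Sum>q<Q. \<Sum>l<Q. p' q l * (w' q * w' l) * (theta Q w' p' q ^ a * theta Q w' p' l ^ b))"
  using double_star_moment_eq[OF law _ _ _ _ w1 w1', of "{2..<2+a}" "{2+a..<2+a+b}" True] n
  by (simp add: mult_ac)

section \<open>Polynomial extension of the moments\<close>

lemma poly_as_sum:
  fixes L :: "real poly"
  assumes "degree L < N"
  shows "poly L x = (\<Sum>k<N. coeff L k * x ^ k)"
  unfolding poly_altdef using assms
  by (intro sum.mono_neutral_left) (auto simp: coeff_eq_0)

lemma lagrange_indicator: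
  fixes X :: "real set"
  assumes X: "finite X" and t: "t \<in> X"
  shows "\<exists>L. degree L < card X \<and> (\<forall>x\<in>X. poly L x = (if x = t then 1 else 0))"
proof -
  define D where "D = (\<Prod>s\<in>X - {t}. t - s)"
  define L where "L = smult (inverse D) (\<Prod>s\<in>X - {t}. [:-s, 1:])"
  have "degree L \<le> degree (\<Prod>s\<in>X - {t}. [:-s, 1:])" unfolding L_def by (rule degree_smult_le)
  also have "\<dots> \<le> (\<Sum>s\<in>X - {t}. degree [:-s, 1::real:])"
    using degree_prod_sum_le[of "X - {t}" "\<lambda>s. [:-s, 1::real:]"] X by (simp add: o_def)
  also have "\<dots> = card (X - {t})" by simp
  also have "\<dots> < card X" by (rule card_Diff1_less[OF X t])
  finally have deg: "degree L < card X" .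
  have D0: "D \<noteq> 0" unfolding D_def using X by (auto simp: prod_zero_iff)
  have eval: "poly L x = inverse D * (\<Prod>s\<in>X - {t}. x - s)" for x
    unfolding L_def by (simp add: poly_prod)
  have "poly L x = (if x = t then 1 else 0)" if "x \<in> X" for x
  proof (cases "x = t")
    case True
    then show ?thesis using D0 by (simp add: eval D_def[symmetric])
  next
    case False
    then have "(\<Prod>s\<in>X - {t}. x - s) = 0" using X that by (auto simp: prod_zero_iff)
    then show ?thesis using False by (simp add: eval)
  qed
  then show ?thesis using deg by blast
qed

lemma indicator_poly:
  fixes x :: "nat \<Rightarrow> real"
  assumes inj: "inj_on x {..<Q}" and q0: "q0 < Q"
  shows "\<exists>L. degree L < Q \<and> (\<forall>q<Q. poly L (x q) = (if q = q0 then 1 else 0))"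
proof -
  obtain L where deg: "degree L < card (x ` {..<Q})"
    and L: "\<forall>y\<in>x ` {..<Q}. poly L y = (if y = x q0 then 1 else 0)"
    using lagrange_indicator[of "x ` {..<Q}" "x q0"] q0 by auto
  have "poly L (x q) = (if q = q0 then 1 else 0)" if "q < Q" for q
    using L that q0 inj by (auto simp: inj_on_eq_iff)
  moreover have "card (x ` {..<Q}) = Q" using card_image[OF inj] by simp
  ultimately show ?thesis using deg by auto
qed

lemma sum_poly_eq_moments:
  fixes L :: "real poly"
  assumes "degree L < N"
  shows "(\<Sum>q\<in>A. u q * poly L (x q)) = (\<Sum>k<N. coeff L k * (\<Sum>q\<in>A. u q * x q ^ k))"
proof -
  have "(\<Sum>q\<in>A. u q * poly L (x q)) = (\<Sum>q\<in>A. \<Sum>k<N. coeff L k * (u q * x q ^ k))"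
    unfolding poly_as_sum[OF assms] by (simp add: sum_distrib_left mult_ac)
  also have "\<dots> = (\<Sum>k<N. coeff L k * (\<Sum>q\<in>A. u q * x q ^ k))"
    by (subst sum.swap) (simp add: sum_distrib_left)
  finally show ?thesis .
qed

lemma sum2_poly_eq_moments:
  fixes L1 L2 :: "real poly"
  assumes d1: "degree L1 < N" and d2: "degree L2 < N"
  shows "(\<Sum>q\<in>A. \<Sum>l\<in>A. G q l * (poly L1 (x q) * poly L2 (x l)))
       = (\<Sum>a<N. \<Sum>b<N. coeff L1 a * coeff L2 b * (\<Sum>q\<in>A. \<Sum>l\<in>A. G q l * (x q ^ a * x l ^ b)))"
proof -
  define t where "t q l a b = coeff L1 a * coeff L2 b * (G q l * (x q ^ a * x l ^ b))" for q l a b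
  have "(\<Sum>q\<in>A. \<Sum>l\<in>A. G q l * (poly L1 (x q) * poly L2 (x l)))
      = (\<Sum>q\<in>A. \<Sum>l\<in>A. \<Sum>a<N. \<Sum>b<N. t q l a b)"
    unfolding poly_as_sum[OF d1] poly_as_sum[OF d2] sum_product t_def
    by (simp add: sum_distrib_left mult_ac)
  also have "\<dots> = (\<Sum>q\<in>A. \<Sum>a<N. \<Sum>b<N. \<Sum>l\<in>A. t q l a b)"
    by (intro sum.cong refl) (subst sum.swap, intro sum.cong refl sum.swap)
  also have "\<dots> = (\<Sum>a<N. \<Sum>b<N. \<Sum>q\<in>A. \<Sum>l\<in>A. t q l a b)"
    by (subst sum.swap, intro sum.cong refl sum.swap)
  finally show ?thesis by (simp add: t_def sum_distrib_left)
qed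

lemma poly_theta_moment_eq:
  fixes L :: "real poly"
  assumes law: "law_K n Q w p = law_K n Q w' p'" and n: "2 * Q + 1 \<le> n"
    and w1: "(\<Sum>l<Q. w l) = 1" and w1': "(\<Sum>l<Q. w' l) = 1" and deg: "degree L < 2 * Q"
  shows "(\<Sum>q<Q. w q * poly L (theta Q w p q)) = (\<Sum>q<Q. w' q * poly L (theta Q w' p' q))"
  unfolding sum_poly_eq_moments[OF deg]
  using theta_moment_eq[OF law _ w1 w1'] n by (intro sum.cong refl) auto

lemma poly_edge_theta_moment_eq:
  fixes L1 L2 :: "real poly"
  assumes law: "law_K n Q w p = law_K n Q w' p'" and n: "2 * Q + 1 \<le> n"
    and w1: "(\<Sum>l<Q. w l) = 1" and w1': "(\<Sum>l<Q. w' l) = 1"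
    and d1: "degree L1 < Q" and d2: "degree L2 < Q"
  shows "(\<Sum>q<Q. \<Sum>l<Q. p q l * (w q * w l) *
            (poly L1 (theta Q w p q) * poly L2 (theta Q w p l)))
       = (\<Sum>q<Q. \<Sum>l<Q. p' q l * (w' q * w' l) *
            (poly L1 (theta Q w' p' q) * poly L2 (theta Q w' p' l)))"
  unfolding sum2_poly_eq_moments[OF d1 d2]
  using edge_theta_moment_eq[OF law _ w1 w1'] n by (intro sum.cong refl) auto

section \<open>Identification when the expected degrees are distinct\<close>

lemma theta_mass_eq:
  assumes law: "law_K n Q w p = law_K n Q w' p'" and n: "2 * Q + 1 \<le> n"
    and w1: "(\<Sum>l<Q. w l) = 1" and w1': "(\<Sum>l<Q. w' l) = 1"
  shows "(\<Sum>q<Q. if theta Q w p q = t then w q else 0)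
       = (\<Sum>r<Q. if theta Q w' p' r = t then w' r else 0)"
proof (cases "t \<in> theta Q w p ` {..<Q} \<union> theta Q w' p' ` {..<Q}")
  case True
  define X where "X = theta Q w p ` {..<Q} \<union> theta Q w' p' ` {..<Q}"
  have "card X \<le> card (theta Q w p ` {..<Q}) + card (theta Q w' p' ` {..<Q})"
    unfolding X_def by (rule card_Un_le)
  also have "\<dots> \<le> 2 * Q"
    using card_image_le[of "{..<Q}" "theta Q w p"] card_image_le[of "{..<Q}" "theta Q w' p'"] by simp
  finally have cardX: "card X \<le> 2 * Q" .
  obtain L where deg: "degree L < card X" and L: "\<forall>x\<in>X. poly L x = (if x = t then 1 else 0)"
    using lagrange_indicator[of X t] True unfolding X_def by auto
  have "(\<Sum>q<Q. w q * poly L (theta Q w p q)) = (\<Sum>q<Q. w' q * poly L (theta Q w' p' q))"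
    using deg cardX by (intro poly_theta_moment_eq[OF law n w1 w1']) simp
  moreover have "w q * poly L (theta Q w p q) = (if theta Q w p q = t then w q else 0)"
    and "w' q * poly L (theta Q w' p' q) = (if theta Q w' p' q = t then w' q else 0)" if "q < Q" for q
    using L that unfolding X_def by auto
  ultimately show ?thesis by simp
next
  case False
  then have "theta Q w p q \<noteq> t" "theta Q w' p' q \<noteq> t" if "q < Q" for q
    using that by auto
  then show ?thesis by (subst (1 2) sum.neutral) auto
qed

lemma mass_at_injective_point:
  fixes th :: "nat \<Rightarrow> 'a" and w :: "nat \<Rightarrow> real"
  assumes "inj_on th {..<Q}" "q0 < Q"
  shows "(\<Sum>q<Q. if th q = th q0 then w q else 0) = w q0"
  using assms by (simp add: inj_on_eq_iff cong: if_cong)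

lemma matching_points:
  fixes th th' :: "nat \<Rightarrow> 'a" and w w' :: "nat \<Rightarrow> real"
  assumes inj: "inj_on th {..<Q}"
    and pos: "\<And>q. q < Q \<Longrightarrow> 0 < w q" and pos': "\<And>q. q < Q \<Longrightarrow> 0 < w' q"
    and mass: "\<And>t. (\<Sum>q<Q. if th q = t then w q else 0) = (\<Sum>r<Q. if th' r = t then w' r else 0)"
  shows "\<exists>\<sigma>. \<sigma> permutes {..<Q} \<and> (\<forall>r<Q. th' r = th (\<sigma> r))"
proof -
  have mass_pos': "0 < (\<Sum>q<Q. if th' q = th' r then w' q else 0)" if "r < Q" for r
  proof -
    have "(if th' r = th' r then w' r else 0) \<le> (\<Sum>q<Q. if th' q = th' r then w' q else 0)"
      by (rule member_le_sum) (use that pos' in \<open>auto intro: less_imp_le\<close>)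
    then show ?thesis using pos'[OF that] by simp
  qed
  have hit: "\<exists>q<Q. th q = th' r" if "r < Q" for r
  proof (rule ccontr)
    assume "\<not> (\<exists>q<Q. th q = th' r)"
    then have "(\<Sum>q<Q. if th q = th' r then w q else 0) = 0" by (intro sum.neutral) auto
    then show False using mass[of "th' r"] mass_pos'[OF that] by simp
  qed
  define \<sigma> where "\<sigma> r = (if r < Q then (SOME q. q < Q \<and> th q = th' r) else r)" for r
  have \<sigma>: "\<sigma> r < Q \<and> th (\<sigma> r) = th' r" if "r < Q" for r
    using someI_ex[OF hit[OF that]] that unfolding \<sigma>_def by simp
  have onto: "{..<Q} \<subseteq> \<sigma> ` {..<Q}"
  proof
    fix q assume q: "q \<in> {..<Q}"
    have "\<exists>r<Q. th' r = th q"
    proof (rule ccontr)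
      assume "\<not> (\<exists>r<Q. th' r = th q)"
      then have "(\<Sum>r<Q. if th' r = th q then w' r else 0) = 0" by (intro sum.neutral) auto
      then show False using mass[of "th q"] mass_at_injective_point[OF inj, of q w] pos[of q] q by simp
    qed
    then obtain r where r: "r < Q" "th' r = th q" by blast
    then have "\<sigma> r = q" using \<sigma>[OF r(1)] inj q by (auto simp: inj_on_eq_iff)
    then show "q \<in> \<sigma> ` {..<Q}" using r by auto
  qed
  have image: "\<sigma> ` {..<Q} = {..<Q}" using onto \<sigma> by auto
  have "bij_betw \<sigma> {..<Q} {..<Q}"
    unfolding bij_betw_def using eq_card_imp_inj_on[of "{..<Q}" \<sigma>] image by simp
  then have "\<sigma> permutes {..<Q}"
    by (rule bij_imp_permutes) (simp add: \<sigma>_def)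
  then show ?thesis using \<sigma> by metis
qed

lemma matching_permutation:
  fixes th th' :: "nat \<Rightarrow> 'a" and w w' :: "nat \<Rightarrow> real"
  assumes inj: "inj_on th {..<Q}"
    and pos: "\<And>q. q < Q \<Longrightarrow> 0 < w q" and pos': "\<And>q. q < Q \<Longrightarrow> 0 < w' q"
    and mass: "\<And>t. (\<Sum>q<Q. if th q = t then w q else 0) = (\<Sum>r<Q. if th' r = t then w' r else 0)"
  shows "\<exists>\<sigma>. \<sigma> permutes {..<Q} \<and> (\<forall>r<Q. th' r = th (\<sigma> r) \<and> w' r = w (\<sigma> r))"
proof -
  obtain \<sigma> where perm: "\<sigma> permutes {..<Q}" and pts: "\<forall>r<Q. th' r = th (\<sigma> r)"
    using matching_points[OF inj pos pos' mass] by blast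
  have inj': "inj_on th' {..<Q}"
  proof (rule inj_onI)
    fix a b assume a: "a \<in> {..<Q}" and b: "b \<in> {..<Q}" and "th' a = th' b"
    then have "th (\<sigma> a) = th (\<sigma> b)" using pts by simp
    then have "\<sigma> a = \<sigma> b" using inj_onD[OF inj] permutes_in_image[OF perm] a b by blast
    then show "a = b" using permutes_inj[OF perm] by (simp add: inj_eq)
  qed
  have "w' r = w (\<sigma> r)" if r: "r < Q" for r
  proof -
    have "w' r = (\<Sum>q<Q. if th' q = th' r then w' q else 0)"
      by (rule mass_at_injective_point[OF inj' r, symmetric])
    also have "\<dots> = (\<Sum>q<Q. if th q = th (\<sigma> r) then w q else 0)"
      using mass[of "th' r"] pts r by simp
    also have "\<dots> = w (\<sigma> r)"
      by (rule mass_at_injective_point[OF inj]) (use permutes_in_image[OF perm] r in simp)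
    finally show ?thesis .
  qed
  then show ?thesis using perm pts by blast
qed

text \<open>Once w and theta are matched by sigma, the mixed moments tested against indicator
  polynomials of the expected degrees isolate each connectivity.\<close>
lemma conn_matched:
  assumes law: "law_K n Q w p = law_K n Q w' p'" and n: "2 * Q + 1 \<le> n"
    and w1: "(\<Sum>l<Q. w l) = 1" and w1': "(\<Sum>l<Q. w' l) = 1" and pos: "\<And>q. q < Q \<Longrightarrow> 0 < w q"
    and inj: "inj_on (theta Q w p) {..<Q}" and perm: "\<sigma> permutes {..<Q}"
    and match: "\<forall>r<Q. theta Q w' p' r = theta Q w p (\<sigma> r) \<and> w' r = w (\<sigma> r)"
    and r: "r < Q" and s: "s < Q"
  shows "p' r s = p (\<sigma> r) (\<sigma> s)"
proof -
  have \<sigma>r: "\<sigma> r < Q" and \<sigma>s: "\<sigma> s < Q" using permutes_in_image[OF perm] r s by auto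
  obtain L1 where d1: "degree L1 < Q" and L1: "\<forall>q<Q. poly L1 (theta Q w p q) = (if q = \<sigma> r then 1 else 0)"
    using indicator_poly[OF inj \<sigma>r] by blast
  obtain L2 where d2: "degree L2 < Q" and L2: "\<forall>q<Q. poly L2 (theta Q w p q) = (if q = \<sigma> s then 1 else 0)"
    using indicator_poly[OF inj \<sigma>s] by blast
  have L1': "poly L1 (theta Q w' p' q) = (if q = r then 1 else 0)"
    and L2': "poly L2 (theta Q w' p' q) = (if q = s then 1 else 0)" if "q < Q" for q
    using L1 L2 match that permutes_in_image[OF perm] permutes_inj[OF perm] by (auto simp: inj_eq)
  have "(\<Sum>q<Q. \<Sum>l<Q. p q l * (w q * w l) * (poly L1 (theta Q w p q) * poly L2 (theta Q w p l)))
      = (\<Sum>q<Q. \<Sum>l<Q. if \<sigma> r = q \<and> \<sigma> s = l then p (\<sigma> r) (\<sigma> s) * (w (\<sigma> r) * w (\<sigma> s)) else 0)"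
    using L1 L2 by (intro sum.cong refl) auto
  also have "\<dots> = p (\<sigma> r) (\<sigma> s) * (w (\<sigma> r) * w (\<sigma> s))" by (rule sum_sum_delta[OF \<sigma>r \<sigma>s])
  finally have lhs: "(\<Sum>q<Q. \<Sum>l<Q. p q l * (w q * w l) * (poly L1 (theta Q w p q) * poly L2 (theta Q w p l)))
      = p (\<sigma> r) (\<sigma> s) * (w (\<sigma> r) * w (\<sigma> s))" .
  have "(\<Sum>q<Q. \<Sum>l<Q. p' q l * (w' q * w' l) * (poly L1 (theta Q w' p' q) * poly L2 (theta Q w' p' l)))
      = (\<Sum>q<Q. \<Sum>l<Q. if r = q \<and> s = l then p' r s * (w' r * w' s) else 0)"
    using L1' L2' by (intro sum.cong refl) auto
  also have "\<dots> = p' r s * (w (\<sigma> r) * w (\<sigma> s))" using sum_sum_delta[OF r s] match r s by simp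
  finally have rhs: "(\<Sum>q<Q. \<Sum>l<Q. p' q l * (w' q * w' l) * (poly L1 (theta Q w' p' q) * poly L2 (theta Q w' p' l)))
      = p' r s * (w (\<sigma> r) * w (\<sigma> s))" .
  have "p (\<sigma> r) (\<sigma> s) * (w (\<sigma> r) * w (\<sigma> s)) = p' r s * (w (\<sigma> r) * w (\<sigma> s))"
    using poly_edge_theta_moment_eq[OF law n w1 w1' d1 d2] unfolding lhs rhs .
  moreover have "w (\<sigma> r) * w (\<sigma> s) \<noteq> 0" using pos[OF \<sigma>r] pos[OF \<sigma>s] by simp
  ultimately show ?thesis by simp
qed

lemma identifiable_if_theta_distinct:
  assumes ps: "param_space Q w p" and ps': "param_space Q w' p'"
    and inj: "inj_on (theta Q w p) {..<Q}"
    and law: "law_K n Q w p = law_K n Q w' p'" and n: "2 * Q + 1 \<le> n"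
  shows "\<exists>\<sigma>. \<sigma> permutes {..<Q} \<and> (\<forall>q<Q. w' q = w (\<sigma> q)) \<and>
             (\<forall>q<Q. \<forall>l<Q. p' q l = p (\<sigma> q) (\<sigma> l))"
proof -
  have pos: "\<And>q. q < Q \<Longrightarrow> 0 < w q" and w1: "(\<Sum>l<Q. w l) = 1"
    and pos': "\<And>q. q < Q \<Longrightarrow> 0 < w' q" and w1': "(\<Sum>l<Q. w' l) = 1"
    using ps ps' unfolding param_space_def open_simplex_def by auto
  obtain \<sigma> where perm: "\<sigma> permutes {..<Q}"
    and match: "\<forall>r<Q. theta Q w' p' r = theta Q w p (\<sigma> r) \<and> w' r = w (\<sigma> r)"
    using matching_permutation[OF inj pos pos' theta_mass_eq[OF law n w1 w1']] by blast
  show ?thesis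
    using perm match conn_matched[OF law n w1 w1' pos inj perm match] by blast
qed

section \<open>The genericity condition\<close>

definition theta_discriminant :: "nat \<Rightarrow> (nat \<Rightarrow> real) \<Rightarrow> (nat \<Rightarrow> nat \<Rightarrow> real) \<Rightarrow> real" where
  "theta_discriminant Q w p =
     (\<Prod>q<Q. \<Prod>r<Q. if q < r then theta Q w p q - theta Q w p r else 1)"

text \<open>theta is linear in w for fixed p and vice versa, hence the discriminant is a
  polynomial in (w, p).\<close>
lemma param_poly_theta_discriminant: "param_poly Q (theta_discriminant Q)"
proof -
  have theta: "param_poly Q (\<lambda>w p. theta Q w p q)" if "q < Q" for q
    unfolding theta_def using that
    by (intro param_poly_sum param_poly_mult param_poly_weight param_poly_conn) auto
  have "param_poly Q (\<lambda>w p. if q < r then theta Q w p q - theta Q w p r else 1)"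
    if "q < Q" "r < Q" for q r
    using that by (cases "q < r") (simp_all add: param_poly_diff theta param_poly_const)
  then have "param_poly Q (\<lambda>w p. \<Prod>q<Q. \<Prod>r<Q. if q < r then theta Q w p q - theta Q w p r else 1)"
    by (intro param_poly_prod) auto
  then show ?thesis by (simp add: theta_discriminant_def[abs_def])
qed

lemma theta_discriminant_nonzero_iff:
  "theta_discriminant Q w p \<noteq> 0 \<longleftrightarrow> inj_on (theta Q w p) {..<Q}"
proof -
  have "theta_discriminant Q w p = 0 \<longleftrightarrow> (\<exists>q<Q. \<exists>r<Q. q < r \<and> theta Q w p q = theta Q w p r)"
    unfolding theta_discriminant_def by (auto simp: prod_zero_iff split: if_splits)
  also have "\<dots> \<longleftrightarrow> \<not> inj_on (theta Q w p) {..<Q}"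
    unfolding inj_on_def by (auto simp: linorder_neq_iff) (metis order.strict_trans)
  finally show ?thesis by blast
qed

text \<open>A witness of genericity: with p q l proportional to q + l + 1 the expected degrees
  are strictly increasing in q, whatever the group proportions.\<close>
definition linear_conn :: "nat \<Rightarrow> nat \<Rightarrow> nat \<Rightarrow> real" where
  "linear_conn Q q l = (real q + real l + 1) / (2 * real Q + 1)"

lemma conn_space_linear_conn: "conn_space Q (linear_conn Q)"
  unfolding conn_space_def linear_conn_def by (auto simp: field_simps)

lemma theta_linear_conn_inj:
  assumes w1: "(\<Sum>l<Q. w l) = 1"
  shows "inj_on (theta Q w (linear_conn Q)) {..<Q}"
proof -
  have "theta Q w (linear_conn Q) q = (real q + (\<Sum>l<Q. w l * (real l + 1))) / (2 * real Q + 1)" for q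
  proof -
    have "theta Q w (linear_conn Q) q = (\<Sum>l<Q. w l * real q + w l * (real l + 1)) / (2 * real Q + 1)"
      unfolding theta_def linear_conn_def sum_divide_distrib
      by (intro sum.cong refl) (simp add: algebra_simps)
    also have "(\<Sum>l<Q. w l * real q + w l * (real l + 1)) = real q * (\<Sum>l<Q. w l) + (\<Sum>l<Q. w l * (real l + 1))"
      by (simp add: sum.distrib sum_distrib_left mult_ac)
    finally show ?thesis using w1 by simp
  qed
  then show ?thesis by (auto intro!: inj_onI simp: divide_cancel_right)
qed

lemma generic_identifiability:
  assumes Q: "0 < Q" and n: "2 * Q + 1 \<le> n"
  shows "\<exists>F. param_poly Q F \<and> (\<exists>w p. param_space Q w p \<and> F w p \<noteq> 0) \<and>
          (\<forall>w p w' p'. param_space Q w p \<and> F w p \<noteq> 0 \<and> param_space Q w' p' \<and>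
              law_K n Q w p = law_K n Q w' p' \<longrightarrow>
              (\<exists>\<sigma>. \<sigma> permutes {..<Q} \<and> (\<forall>q<Q. w' q = w (\<sigma> q)) \<and>
                   (\<forall>q<Q. \<forall>l<Q. p' q l = p (\<sigma> q) (\<sigma> l))))"
proof (intro exI[of _ "theta_discriminant Q"] conjI allI impI)
  show "param_poly Q (theta_discriminant Q)" by (rule param_poly_theta_discriminant)
  have uniform: "open_simplex Q (\<lambda>_. 1 / real Q)" unfolding open_simplex_def using Q by simp
  show "\<exists>w p. param_space Q w p \<and> theta_discriminant Q w p \<noteq> 0"
  proof (intro exI conjI)
    show "param_space Q (\<lambda>_. 1 / real Q) (linear_conn Q)"
      using uniform conn_space_linear_conn unfolding param_space_def by simp
    show "theta_discriminant Q (\<lambda>_. 1 / real Q) (linear_conn Q) \<noteq> 0"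
      using uniform theta_linear_conn_inj theta_discriminant_nonzero_iff
      unfolding open_simplex_def by blast
  qed
next
  fix w p w' p'
  assume "param_space Q w p \<and> theta_discriminant Q w p \<noteq> 0 \<and> param_space Q w' p' \<and>
          law_K n Q w p = law_K n Q w' p'"
  then show "\<exists>\<sigma>. \<sigma> permutes {..<Q} \<and> (\<forall>q<Q. w' q = w (\<sigma> q)) \<and>
                (\<forall>q<Q. \<forall>l<Q. p' q l = p (\<sigma> q) (\<sigma> l))"
    using identifiable_if_theta_distinct[OF _ _ _ _ n] theta_discriminant_nonzero_iff by blast
qed

lemma generic_identifiability_fixed_weights:
  assumes w: "open_simplex Q w" and n: "2 * Q + 1 \<le> n"
  shows "\<exists>G. conn_poly Q G \<and> (\<exists>p. conn_space Q p \<and> G p \<noteq> 0) \<and>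
          (\<forall>p p'. conn_space Q p \<and> G p \<noteq> 0 \<and> conn_space Q p' \<and>
              law_K n Q w p = law_K n Q w p' \<longrightarrow>
              (\<exists>\<sigma>. \<sigma> permutes {..<Q} \<and> (\<forall>q<Q. w q = w (\<sigma> q)) \<and>
                   (\<forall>q<Q. \<forall>l<Q. p' q l = p (\<sigma> q) (\<sigma> l))))"
proof (intro exI[of _ "theta_discriminant Q w"] conjI allI impI)
  show "conn_poly Q (theta_discriminant Q w)"
    by (rule param_poly_fix_weights[OF param_poly_theta_discriminant])
  show "\<exists>p. conn_space Q p \<and> theta_discriminant Q w p \<noteq> 0"
    using w conn_space_linear_conn theta_linear_conn_inj theta_discriminant_nonzero_iff
    unfolding open_simplex_def by blast
next
  fix p p'
  assume "conn_space Q p \<and> theta_discriminant Q w p \<noteq> 0 \<and> conn_space Q p' \<and>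
          law_K n Q w p = law_K n Q w p'"
  then show "\<exists>\<sigma>. \<sigma> permutes {..<Q} \<and> (\<forall>q<Q. w q = w (\<sigma> q)) \<and>
                (\<forall>q<Q. \<forall>l<Q. p' q l = p (\<sigma> q) (\<sigma> l))"
    using w identifiable_if_theta_distinct[OF _ _ _ _ n, of w p w p'] theta_discriminant_nonzero_iff
    unfolding param_space_def by blast
qed

text \<open>The size hypothesis of the theorem only enters through m \<ge> Q + 1.\<close>
lemma size_bound:
  fixes Q m :: nat
  assumes Q: "Q \<ge> 3"
    and even: "even Q \<Longrightarrow> real m \<ge> real Q - 1 + (real Q + 2)^2 / 4"
    and odd: "odd Q \<Longrightarrow> real m \<ge> real Q - 1 + (real Q + 1) * (real Q + 3) / 4"
  shows "2 * Q + 1 \<le> m^2"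
proof -
  have "real m \<ge> real Q + 1"
  proof (cases "even Q")
    case True
    have "(5::real)^2 \<le> (real Q + 2)^2" using Q by (intro power_mono) auto
    then show ?thesis using even[OF True] by simp
  next
    case False
    have "(2::real) * 4 \<le> (real Q + 1) * (real Q + 3)" using Q by (intro mult_mono) auto
    then show ?thesis using odd[OF False] by simp
  qed
  then have "(Q + 1)^2 \<le> m^2" by (intro power_mono) linarith+
  moreover have "2 * Q + 1 \<le> (Q + 1)^2" by (simp add: power2_eq_square)
  ultimately show ?thesis by linarith
qed

theorem theorem2:
  fixes Q m :: nat
  assumes "Q \<ge> 3"
    and "even Q \<Longrightarrow> real m \<ge> real Q - 1 + (real Q + 2)^2 / 4"
    and "odd Q \<Longrightarrow> real m \<ge> real Q - 1 + (real Q + 1) * (real Q + 3) / 4"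
  shows
    "(\<exists>F. param_poly Q F \<and> (\<exists>w p. param_space Q w p \<and> F w p \<noteq> 0) \<and>
        (\<forall>w p w' p'. param_space Q w p \<and> F w p \<noteq> 0 \<and> param_space Q w' p' \<and>
            law_K (m^2) Q w p = law_K (m^2) Q w' p' \<longrightarrow>
            (\<exists>\<sigma>. \<sigma> permutes {..<Q} \<and> (\<forall>q<Q. w' q = w (\<sigma> q)) \<and>
                 (\<forall>q<Q. \<forall>l<Q. p' q l = p (\<sigma> q) (\<sigma> l)))))
     \<and>
     (\<forall>w. open_simplex Q w \<longrightarrow>
       (\<exists>G. conn_poly Q G \<and> (\<exists>p. conn_space Q p \<and> G p \<noteq> 0) \<and>
         (\<forall>p p'. conn_space Q p \<and> G p \<noteq> 0 \<and> conn_space Q p' \<and>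
             law_K (m^2) Q w p = law_K (m^2) Q w p' \<longrightarrow>
             (\<exists>\<sigma>. \<sigma> permutes {..<Q} \<and> (\<forall>q<Q. w q = w (\<sigma> q)) \<and>
                  (\<forall>q<Q. \<forall>l<Q. p' q l = p (\<sigma> q) (\<sigma> l))))))"
proof -
  have n: "2 * Q + 1 \<le> m^2" by (rule size_bound[OF assms])
  have "0 < Q" using assms(1) by simp
  then show ?thesis
    using generic_identifiability[OF _ n] generic_identifiability_fixed_weights[OF _ n] by blast
qed

end
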